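(* Let $q\ge2$ and $n\ge1$. The $W_t(j)$ coefficients for the $q$-ary quantum Hamming metric of length $n$ are given by $$W_t(j)=\frac1{q^n}\sum_{s=0}^{t}(-1)^s(q^2-1)^{t-s}\binom js\binom{n-j}{t-s}\qquad\text{for }0\le t,j\le n.$$
   Context: $\mathcal{H}=(\mathbb{C}^q)^{\otimes n}$; the $q$-ary quantum Hamming metric is $\mathcal{E}_t=\operatorname{span}\{A_1\otimes\cdots\otimes A_n: A_k\in M_q(\mathbb{C})$, at most $t$ of the $A_k$ not proportional to $I_q\}$. Its diameter is $r=n$. On $\mathcal{L}(\mathcal{H})$ use the Hilbert–Schmidt inner product $\operatorname{tr}(E^*F)$; put $\mathcal{V}_0=\mathbb{C}I_{\mathcal{H}}$ and $\mathcal{V}_t=\mathcal{E}_t\cap\mathcal{E}_{t-1}^\perp$ for $1\le t\le n$. $W_t(j)$ coefficients: for $\mathcal{B}_t$ any orthonormal basis of $\mathcal{V}_t$, let $\Phi_t(X)=\sum_{E\in\mathcal{B}_t}EXE^*$ and let $\Pi_t(X)=\sum_{E\in\mathcal{B}_t}\operatorname{tr}(E^*X)E$ (the orthogonal projection onto $\mathcal{V}_t$), as linear maps on the self-adjoint operators. The coefficients $W_t(j)\in\mathbb{R}$ are the unique numbers with $\Phi_t=\sum_{j=0}^{r}W_t(j)\Pi_j$ for $0\le t\le r$; equivalently $\Phi_t(X)=W_t(j)X$ for $X\in\mathcal{V}_j$ (such numbers exist for this metric). *)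

theory Defs
  imports "HOL-Analysis.Analysis"
begin

type_synonym 'm cmat = "complex ^ 'm ^ 'm"

definition cmat_scale :: "complex \<Rightarrow> 'm::finite cmat \<Rightarrow> 'm cmat" (infixr \<open>*\<^sub>M\<close> 75) where
  "c *\<^sub>M A = (\<chi> x y. c * A $ x $ y)"

text \<open>The library's \<open>span\<close> is the real span and \<open>vec.span\<close> applies only to vectors of scalars,
  so complex linear spans of matrices need their own instance of \<^locale>\<open>vector_space\<close>.\<close>

interpretation cmat: vector_space "cmat_scale :: complex \<Rightarrow> 'm::finite cmat \<Rightarrow> 'm cmat"
  by standard (simp_all add: cmat_scale_def vec_eq_iff algebra_simps)

definition cmat_adjoint :: "'m::finite cmat \<Rightarrow> 'm cmat" where
  "cmat_adjoint A = (\<chi> x y. cnj (A $ y $ x))"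

definition self_adjoint :: "'m::finite cmat \<Rightarrow> bool" where
  "self_adjoint A \<longleftrightarrow> cmat_adjoint A = A"

definition hs_inner :: "'m::finite cmat \<Rightarrow> 'm cmat \<Rightarrow> complex" where
  "hs_inner E F = trace (cmat_adjoint E ** F)"

definition hs_orthonormal_basis :: "'m::finite cmat set \<Rightarrow> 'm cmat set \<Rightarrow> bool" where
  "hs_orthonormal_basis B V \<longleftrightarrow>
     finite B \<and> (\<forall>E\<in>B. \<forall>F\<in>B. hs_inner E F = (if E = F then 1 else 0)) \<and> cmat.span B = V"

definition hs_complement :: "'m::finite cmat set \<Rightarrow> 'm cmat set" where
  "hs_complement S = {F. \<forall>E\<in>S. hs_inner E F = 0}"

text \<open>Throughout, \<open>\<E> t\<close> is the space of operators of distance at most \<open>t\<close> of a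
  quantum metric on \<open>\<complex>\<^sup>m\<close>, and \<open>r\<close> is its diameter.\<close>

definition graded_part :: "(nat \<Rightarrow> 'm::finite cmat set) \<Rightarrow> nat \<Rightarrow> 'm cmat set" where
  "graded_part \<E> t = (if t = 0 then cmat.span {mat 1} else \<E> t \<inter> hs_complement (\<E> (t - 1)))"

definition kraus_map :: "'m::finite cmat set \<Rightarrow> 'm cmat \<Rightarrow> 'm cmat" where
  "kraus_map B X = (\<Sum>E\<in>B. E ** X ** cmat_adjoint E)"

definition basis_projection :: "'m::finite cmat set \<Rightarrow> 'm cmat \<Rightarrow> 'm cmat" where
  "basis_projection B X = (\<Sum>E\<in>B. hs_inner E X *\<^sub>M E)"

text \<open>\<open>W_coeff \<E> r t\<close> is the unique tuple \<open>(W\<^sub>t(0), \<dots>, W\<^sub>t(r))\<close>, encoded as a function that is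
  extensional on \<open>{..r}\<close> so that it can be unique.\<close>

definition W_coeff :: "(nat \<Rightarrow> 'm::finite cmat set) \<Rightarrow> nat \<Rightarrow> nat \<Rightarrow> nat \<Rightarrow> real" where
  "W_coeff \<E> r t = (THE w. w \<in> extensional {..r} \<and>
     (\<forall>B X. (\<forall>j\<le>r. hs_orthonormal_basis (B j) (graded_part \<E> j)) \<longrightarrow> self_adjoint X \<longrightarrow>
        kraus_map (B t) X = (\<Sum>j\<le>r. w j *\<^sub>R basis_projection (B j) X)))"

text \<open>With \<open>q = CARD('q)\<close> and \<open>n = CARD('n)\<close>, the standard basis of \<open>(\<complex>\<^sup>q)\<^sup>\<otimes>\<^sup>n\<close> is indexed by
  functions of type \<open>'n \<Rightarrow> 'q\<close>.\<close>

definition tensor_product :: "('n::finite \<Rightarrow> 'q::finite cmat) \<Rightarrow> ('n \<Rightarrow> 'q) cmat" where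
  "tensor_product A = (\<chi> x y. \<Prod>k\<in>UNIV. A k $ x k $ y k)"

definition quantum_hamming :: "nat \<Rightarrow> ('n::finite \<Rightarrow> 'q::finite) cmat set" where
  "quantum_hamming t =
     cmat.span {tensor_product A |A. card {k. \<not> (\<exists>c. A k = c *\<^sub>M mat 1)} \<le> t}"

end

theory Submission imports Defs begin

text \<open>At a single site, write \<open>P\<^sub>0(A) = tr(A) I / q\<close> and \<open>P\<^sub>1 = id - P\<^sub>0\<close>. The orthogonal
  projection onto \<open>V\<^sub>t\<close> is the sum, over all sets \<open>S\<close> of \<open>t\<close> sites, of the tensor products of \<open>P\<^sub>1\<close> on
  \<open>S\<close> and \<open>P\<^sub>0\<close> off \<open>S\<close>. A Kraus map depends only on the projection onto the span of its
  orthonormal family, and its kernel is obtained from the kernel of that projection by exchanging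
  two of the four matrix indices. At a single site this exchange turns \<open>P\<^sub>0\<close> into \<open>(P\<^sub>0 + P\<^sub>1) / q\<close> and
  \<open>P\<^sub>1\<close> into \<open>((q\<^sup>2 - 1) P\<^sub>0 - P\<^sub>1) / q\<close>. Multiplying over the sites, the coefficient at an operator
  supported on \<open>J\<close> is the sum over \<open>S\<close> of \<open>(-1)^|S \<inter> J| (q\<^sup>2 - 1)^|S - J| / q^n\<close>, which is the stated
  sum once the sets \<open>S\<close> are grouped by \<open>s = |S \<inter> J|\<close>.\<close>

subsection \<open>Matrix preliminaries\<close>

lemma cmat_scale_nth [simp]: "(c *\<^sub>M A) $ x $ y = c * A $ x $ y"
  by (simp add: cmat_scale_def)

lemma sum_swap_pairs:
  fixes f :: "'a::finite \<Rightarrow> 'b::finite \<Rightarrow> 'c::finite \<Rightarrow> 'd::finite \<Rightarrow> 'e::comm_monoid_add"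
  shows "(\<Sum>a\<in>UNIV. \<Sum>b\<in>UNIV. \<Sum>x\<in>UNIV. \<Sum>y\<in>UNIV. f a b x y) =
    (\<Sum>x\<in>UNIV. \<Sum>y\<in>UNIV. \<Sum>a\<in>UNIV. \<Sum>b\<in>UNIV. f a b x y)"
proof -
  have "(\<Sum>a\<in>UNIV. \<Sum>b\<in>UNIV. \<Sum>x\<in>UNIV. \<Sum>y\<in>UNIV. f a b x y) = (\<Sum>a\<in>UNIV. \<Sum>x\<in>UNIV. \<Sum>b\<in>UNIV. \<Sum>y\<in>UNIV. f a b x y)"
    by (intro sum.cong refl sum.swap)
  also have "\<dots> = (\<Sum>x\<in>UNIV. \<Sum>a\<in>UNIV. \<Sum>b\<in>UNIV. \<Sum>y\<in>UNIV. f a b x y)"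
    by (rule sum.swap)
  also have "\<dots> = (\<Sum>x\<in>UNIV. \<Sum>a\<in>UNIV. \<Sum>y\<in>UNIV. \<Sum>b\<in>UNIV. f a b x y)"
    by (intro sum.cong refl sum.swap)
  also have "\<dots> = (\<Sum>x\<in>UNIV. \<Sum>y\<in>UNIV. \<Sum>a\<in>UNIV. \<Sum>b\<in>UNIV. f a b x y)"
    by (intro sum.cong refl sum.swap)
  finally show ?thesis .
qed

lemma hs_inner_eq: "hs_inner E F = (\<Sum>a\<in>UNIV. \<Sum>b\<in>UNIV. cnj (E $ a $ b) * F $ a $ b)"
  unfolding hs_inner_def trace_def matrix_matrix_mult_def cmat_adjoint_def
  by (simp, rule sum.swap)

lemma hs_inner_add_right: "hs_inner E (F + G) = hs_inner E F + hs_inner E G"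
  by (simp add: hs_inner_eq algebra_simps sum.distrib)

lemma hs_inner_diff_right: "hs_inner E (F - G) = hs_inner E F - hs_inner E G"
  by (simp add: hs_inner_eq algebra_simps sum_subtractf)

lemma hs_inner_scale_right: "hs_inner E (c *\<^sub>M F) = c * hs_inner E F"
  by (simp add: hs_inner_eq sum_distrib_left mult.left_commute)

lemma hs_inner_scale_left: "hs_inner (c *\<^sub>M E) F = cnj c * hs_inner E F"
  by (simp add: hs_inner_eq sum_distrib_left mult.assoc)

lemma hs_inner_zero_left [simp]: "hs_inner 0 F = 0"
  and hs_inner_zero_right [simp]: "hs_inner E 0 = 0"
  by (simp_all add: hs_inner_eq)

lemma hs_inner_sum_right: "hs_inner E (sum f A) = (\<Sum>i\<in>A. hs_inner E (f i))"
  by (induction A rule: infinite_finite_induct) (auto simp: hs_inner_add_right)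

lemma hs_inner_commute: "hs_inner F E = cnj (hs_inner E F)"
  by (simp add: hs_inner_eq mult.commute)

lemma hs_inner_self:
  "hs_inner E E = complex_of_real (\<Sum>a\<in>UNIV. \<Sum>b\<in>UNIV. (cmod (E $ a $ b))\<^sup>2)"
proof -
  have "cnj z * z = complex_of_real ((cmod z)\<^sup>2)" for z
    by (metis complex_norm_square mult.commute)
  then show ?thesis
    by (simp add: hs_inner_eq)
qed

lemma hs_inner_self_eq_0_iff: "hs_inner E E = 0 \<longleftrightarrow> E = 0"
proof
  assume "hs_inner E E = 0"
  then have "(\<Sum>a\<in>UNIV. \<Sum>b\<in>UNIV. (cmod (E $ a $ b))\<^sup>2) = 0"
    unfolding hs_inner_self of_real_eq_0_iff .
  then have "(\<Sum>b\<in>UNIV. (cmod (E $ a $ b))\<^sup>2) = 0" for a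
    by (subst (asm) sum_nonneg_eq_0_iff) (auto intro: sum_nonneg)
  then have "E $ a $ b = 0" for a b
    by (subst (asm) sum_nonneg_eq_0_iff) auto
  then show "E = 0"
    by (simp add: vec_eq_iff)
qed simp

definition matrix_unit :: "'m::finite \<Rightarrow> 'm \<Rightarrow> 'm cmat" where
  "matrix_unit x y = (\<chi> a b. of_bool (a = x \<and> b = y))"

lemma matrix_unit_nth [simp]: "matrix_unit x y $ a $ b = of_bool (a = x \<and> b = y)"
  by (simp add: matrix_unit_def)

lemma hs_inner_matrix_unit: "hs_inner E (matrix_unit x y) = cnj (E $ x $ y)"
proof -
  have "hs_inner E (matrix_unit x y) =
    (\<Sum>a\<in>UNIV. \<Sum>b\<in>UNIV. if b = y then (if a = x then cnj (E $ a $ b) else 0) else 0)"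
    unfolding hs_inner_eq by (intro sum.cong) auto
  then show ?thesis
    by simp
qed

subsection \<open>Orthonormal bases\<close>

lemma basis_projection_eq_self:
  assumes "hs_orthonormal_basis B V" "X \<in> V"
  shows "basis_projection B X = X"
proof -
  have fin: "finite B" and orth: "\<And>E F. E \<in> B \<Longrightarrow> F \<in> B \<Longrightarrow> hs_inner E F = (if E = F then 1 else 0)"
    and X: "X \<in> cmat.span B"
    using assms by (auto simp: hs_orthonormal_basis_def)
  obtain c where c: "X = (\<Sum>E\<in>B. c E *\<^sub>M E)"
    using X fin by (auto simp: cmat.span_finite)
  have "hs_inner E X = c E" if "E \<in> B" for E
  proof -
    have "hs_inner E X = (\<Sum>F\<in>B. if F = E then c F else 0)"
      unfolding c hs_inner_sum_right hs_inner_scale_right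
      using that orth by (intro sum.cong) auto
    then show ?thesis
      using that fin by simp
  qed
  then show ?thesis
    unfolding basis_projection_def by (subst (2) c) (intro sum.cong, auto)
qed

text \<open>Orthogonality to \<open>V\<close> forces \<open>X\<close> and \<open>Y\<close> to have
  the same coefficients along \<open>B\<close>, and \<open>Y\<close> is reproduced by its own. The
  result depends on \<open>V\<close> alone, so a projection can be computed without knowing the
  basis.\<close>

lemma basis_projection_unique:
  assumes B: "hs_orthonormal_basis B V" and Y: "Y \<in> V"
    and orth: "\<And>E. E \<in> V \<Longrightarrow> hs_inner E (X - Y) = 0"
  shows "basis_projection B X = Y"
proof -
  have "E \<in> V" if "E \<in> B" for E
    using B that cmat.span_base by (auto simp: hs_orthonormal_basis_def)
  then have "hs_inner E X = hs_inner E Y" if "E \<in> B" for E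
    using orth that by (auto simp: hs_inner_diff_right)
  then have "basis_projection B X = basis_projection B Y"
    by (simp add: basis_projection_def)
  then show ?thesis
    using basis_projection_eq_self [OF B Y] by simp
qed

text \<open>Gram-Schmidt, by induction on the spanning set. Existence matters for the uniqueness of
  the coefficients: their defining condition quantifies over orthonormal bases and would be vacuous
  if there were none.\<close>

lemma orthonormal_basis_exists:
  assumes "finite S"
  shows "\<exists>B. hs_orthonormal_basis B (cmat.span S)"
  using assms
proof induction
  case empty
  then show ?case
    by (intro exI [of _ "{}"]) (simp add: hs_orthonormal_basis_def)
next
  case (insert v S)
  then obtain B where B: "hs_orthonormal_basis B (cmat.span S)"
    by blast
  then have fin: "finite B" and span: "cmat.span B = cmat.span S"
    and orth: "\<And>E F. E \<in> B \<Longrightarrow> F \<in> B \<Longrightarrow> hs_inner E F = (if E = F then 1 else 0)"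
    by (auto simp: hs_orthonormal_basis_def)
  \<comment> \<open>The component of \<open>v\<close> in the span reached so far. Either it is all
    of \<open>v\<close>, and \<open>B\<close> still serves, or the residual \<open>v - p\<close> is
    normalised to a new basis vector \<open>u\<close>.\<close>
  define p where "p = basis_projection B v"
  have p_span: "p \<in> cmat.span B"
    unfolding p_def basis_projection_def
    by (intro cmat.span_sum cmat.span_scale cmat.span_base)
  have ins: "cmat.span (insert v B) = cmat.span (insert v S)"
    by (simp add: cmat.span_insert span)
  show ?case
  proof (cases "v = p")
    case True
    then have "cmat.span (insert v S) = cmat.span S"
      using p_span span by (simp add: cmat.span_redundant)
    then show ?thesis
      using B by auto
  next
    case False
    define s where "s = (\<Sum>a\<in>UNIV. \<Sum>b\<in>UNIV. (cmod ((v - p) $ a $ b))\<^sup>2)"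
    have s: "hs_inner (v - p) (v - p) = complex_of_real s"
      unfolding s_def by (rule hs_inner_self)
    then have "s \<noteq> 0"
      using False hs_inner_self_eq_0_iff [of "v - p"] by auto
    moreover have "s \<ge> 0"
      unfolding s_def by (intro sum_nonneg) auto
    ultimately have "s > 0"
      by simp
    define c where "c = complex_of_real (1 / sqrt s)"
    define u where "u = c *\<^sub>M (v - p)"
    have "c \<noteq> 0"
      using \<open>s > 0\<close> by (simp add: c_def)
    have uu: "hs_inner u u = 1"
    proof -
      have "hs_inner u u = complex_of_real (1 / sqrt s * (1 / sqrt s) * s)"
        unfolding u_def hs_inner_scale_left hs_inner_scale_right s c_def
        by (simp only: complex_cnj_complex_of_real of_real_mult mult.assoc)
      also have "1 / sqrt s * (1 / sqrt s) * s = 1"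
        using \<open>s > 0\<close> by (simp add: field_simps)
      finally show ?thesis
        by simp
    qed
    have Eu: "hs_inner E u = 0" if "E \<in> B" for E
    proof -
      have "hs_inner E p = (\<Sum>F\<in>B. if F = E then hs_inner F v else 0)"
        unfolding p_def basis_projection_def hs_inner_sum_right hs_inner_scale_right
        using that orth by (intro sum.cong) auto
      then have "hs_inner E p = hs_inner E v"
        using that fin by simp
      then show ?thesis
        by (simp add: u_def hs_inner_scale_right hs_inner_diff_right)
    qed
    have uE: "hs_inner u E = 0" if "E \<in> B" for E
      using Eu [OF that] hs_inner_commute [of u E] by simp
    have p_span': "p \<in> cmat.span (insert w B)" for w
      using p_span cmat.span_mono [of B "insert w B"] by blast
    then have u_span: "u \<in> cmat.span (insert v B)"
      unfolding u_def by (intro cmat.span_scale cmat.span_diff) (simp_all add: cmat.span_base)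
    \<comment> \<open>Undoing the normalisation shows that exchanging \<open>v\<close> for
      \<open>u\<close> does not shrink the span.\<close>
    have "v = (1 / c) *\<^sub>M u + p"
      using \<open>c \<noteq> 0\<close> by (simp add: u_def vec_eq_iff)
    moreover have "(1 / c) *\<^sub>M u + p \<in> cmat.span (insert u B)"
      using p_span' by (intro cmat.span_add cmat.span_scale) (simp_all add: cmat.span_base)
    ultimately have v_span: "v \<in> cmat.span (insert u B)"
      by simp
    have "cmat.span (insert u B) = cmat.span (insert v B)"
    proof (rule antisym)
      show "cmat.span (insert u B) \<subseteq> cmat.span (insert v B)"
        using u_span by (intro cmat.span_minimal) (auto intro: cmat.span_base)
      show "cmat.span (insert v B) \<subseteq> cmat.span (insert u B)"
        using v_span by (intro cmat.span_minimal) (auto intro: cmat.span_base)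
    qed
    moreover have "u \<notin> B"
      using uu Eu by auto
    ultimately have "hs_orthonormal_basis (insert u B) (cmat.span (insert v S))"
      using fin orth uu uE Eu ins by (auto simp: hs_orthonormal_basis_def)
    then show ?thesis
      by blast
  qed
qed

text \<open>Both sides rest on the numbers \<open>E $ a $ b * cnj (E $ d $ c)\<close> summed over
  \<open>B\<close>. Read from \<open>(d, c)\<close> to \<open>(a, b)\<close> they form the kernel of
  the projection; read from \<open>(b, c)\<close> to \<open>(a, d)\<close> they form the kernel of
  the Kraus map. This is the exchange of indices.\<close>

lemma kraus_map_nth:
  "kraus_map B X $ a $ d =
    (\<Sum>b\<in>UNIV. \<Sum>c\<in>UNIV. basis_projection B (matrix_unit d c) $ a $ b * X $ b $ c)"
proof -
  have "kraus_map B X $ a $ d =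
    (\<Sum>E\<in>B. \<Sum>c\<in>UNIV. \<Sum>b\<in>UNIV. cnj (E $ d $ c) * E $ a $ b * X $ b $ c)"
    unfolding kraus_map_def matrix_matrix_mult_def cmat_adjoint_def
    by (simp add: sum_distrib_left sum_distrib_right mult_ac)
  also have "\<dots> = (\<Sum>E\<in>B. \<Sum>b\<in>UNIV. \<Sum>c\<in>UNIV. cnj (E $ d $ c) * E $ a $ b * X $ b $ c)"
    by (intro sum.cong refl sum.swap)
  also have "\<dots> = (\<Sum>b\<in>UNIV. \<Sum>E\<in>B. \<Sum>c\<in>UNIV. cnj (E $ d $ c) * E $ a $ b * X $ b $ c)"
    by (rule sum.swap)
  also have "\<dots> = (\<Sum>b\<in>UNIV. \<Sum>c\<in>UNIV. \<Sum>E\<in>B. cnj (E $ d $ c) * E $ a $ b * X $ b $ c)"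
    by (intro sum.cong refl sum.swap)
  also have "\<dots> = (\<Sum>b\<in>UNIV. \<Sum>c\<in>UNIV. basis_projection B (matrix_unit d c) $ a $ b * X $ b $ c)"
    by (simp add: basis_projection_def hs_inner_matrix_unit sum_distrib_right)
  finally show ?thesis .
qed

subsection \<open>Kernels\<close>

definition kernel_map ::
    "('m \<Rightarrow> 'm \<Rightarrow> 'm \<Rightarrow> 'm \<Rightarrow> complex) \<Rightarrow> 'm::finite cmat \<Rightarrow> 'm cmat" where
  "kernel_map N X = (\<chi> a b. \<Sum>x\<in>UNIV. \<Sum>y\<in>UNIV. N a b x y * X $ x $ y)"

lemma kernel_map_nth [simp]:
  "kernel_map N X $ a $ b = (\<Sum>x\<in>UNIV. \<Sum>y\<in>UNIV. N a b x y * X $ x $ y)"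
  by (simp add: kernel_map_def)

lemma kernel_map_add: "kernel_map N (X + Y) = kernel_map N X + kernel_map N Y"
  by (simp add: vec_eq_iff algebra_simps sum.distrib)

lemma kernel_map_scale: "kernel_map N (c *\<^sub>M X) = c *\<^sub>M kernel_map N X"
  by (simp add: vec_eq_iff sum_distrib_left mult_ac)

lemma kernel_map_zero [simp]: "kernel_map N 0 = 0"
  by (simp add: vec_eq_iff)

lemma kernel_map_sum: "kernel_map N (sum f A) = (\<Sum>i\<in>A. kernel_map N (f i))"
  by (induction A rule: infinite_finite_induct) (simp_all add: kernel_map_add)

lemma kernel_map_matrix_unit: "kernel_map N (matrix_unit x y) $ a $ b = N a b x y"
proof -
  have "kernel_map N (matrix_unit x y) $ a $ b =
    (\<Sum>u\<in>UNIV. \<Sum>v\<in>UNIV. if v = y then (if u = x then N a b u v else 0) else 0)"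
    unfolding kernel_map_nth by (intro sum.cong) auto
  then show ?thesis
    by simp
qed

lemma cmat_eq_sum_matrix_unit: "X = (\<Sum>x\<in>UNIV. \<Sum>y\<in>UNIV. X $ x $ y *\<^sub>M matrix_unit x y)"
proof -
  have "(\<Sum>x\<in>UNIV. \<Sum>y\<in>UNIV. X $ x $ y *\<^sub>M matrix_unit x y) $ a $ b = X $ a $ b" for a b
  proof -
    have "(\<Sum>x\<in>UNIV. \<Sum>y\<in>UNIV. X $ x $ y *\<^sub>M matrix_unit x y) $ a $ b =
      (\<Sum>x\<in>UNIV. \<Sum>y\<in>UNIV. if y = b then (if x = a then X $ x $ y else 0) else 0)"
      unfolding sum_component cmat_scale_nth matrix_unit_nth by (intro sum.cong) auto
    then show ?thesis
      by simp
  qed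
  then show ?thesis
    by (simp only: vec_eq_iff) simp
qed

text \<open>Gives the range of a kernel map a finite spanning set, as Gram-Schmidt requires, and
  reduces claims about the range to matrix units.\<close>

lemma kernel_map_in_span_units:
  "kernel_map N X \<in> cmat.span (range (\<lambda>(x, y). kernel_map N (matrix_unit x y)))"
proof -
  have "kernel_map N X = (\<Sum>x\<in>UNIV. \<Sum>y\<in>UNIV. X $ x $ y *\<^sub>M kernel_map N (matrix_unit x y))"
    by (subst cmat_eq_sum_matrix_unit [of X]) (simp only: kernel_map_sum kernel_map_scale)
  moreover have "X $ x $ y *\<^sub>M kernel_map N (matrix_unit x y) \<in>
      cmat.span (range (\<lambda>(x, y). kernel_map N (matrix_unit x y)))" for x y
    by (intro cmat.span_scale cmat.span_base) (auto intro: rev_image_eqI)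
  ultimately show ?thesis
    by (simp only: cmat.span_sum)
qed

lemma kernel_map_comp:
  "kernel_map N (kernel_map M X) =
    kernel_map (\<lambda>a b c d. \<Sum>x\<in>UNIV. \<Sum>y\<in>UNIV. N a b x y * M x y c d) X"
proof -
  have "kernel_map N (kernel_map M X) $ a $ b =
    kernel_map (\<lambda>a b c d. \<Sum>x\<in>UNIV. \<Sum>y\<in>UNIV. N a b x y * M x y c d) X $ a $ b" for a b
  proof -
    have "kernel_map N (kernel_map M X) $ a $ b =
      (\<Sum>x\<in>UNIV. \<Sum>y\<in>UNIV. \<Sum>c\<in>UNIV. \<Sum>d\<in>UNIV. N a b x y * M x y c d * X $ c $ d)"
      by (simp add: sum_distrib_left mult.assoc)
    also have "\<dots> = (\<Sum>c\<in>UNIV. \<Sum>d\<in>UNIV. \<Sum>x\<in>UNIV. \<Sum>y\<in>UNIV. N a b x y * M x y c d * X $ c $ d)"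
      by (rule sum_swap_pairs)
    finally show ?thesis
      by (simp add: sum_distrib_right)
  qed
  then show ?thesis
    by (simp only: vec_eq_iff) simp
qed

text \<open>A Hermitian kernel defines a self-adjoint map for the Hilbert-Schmidt inner
  product.\<close>

lemma hs_inner_kernel_map:
  assumes "\<And>a b x y. cnj (N a b x y) = N x y a b"
  shows "hs_inner (kernel_map N E) F = hs_inner E (kernel_map N F)"
proof -
  have "hs_inner (kernel_map N E) F =
    (\<Sum>a\<in>UNIV. \<Sum>b\<in>UNIV. \<Sum>x\<in>UNIV. \<Sum>y\<in>UNIV. cnj (E $ x $ y) * (N x y a b * F $ a $ b))"
    by (simp add: hs_inner_eq sum_distrib_left sum_distrib_right assms mult_ac)
  also have "\<dots> = (\<Sum>x\<in>UNIV. \<Sum>y\<in>UNIV. \<Sum>a\<in>UNIV. \<Sum>b\<in>UNIV. cnj (E $ x $ y) * (N x y a b * F $ a $ b))"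
    by (rule sum_swap_pairs)
  also have "\<dots> = hs_inner E (kernel_map N F)"
    by (simp add: hs_inner_eq sum_distrib_left)
  finally show ?thesis .
qed

subsection \<open>The projections onto the tensor components\<close>

text \<open>\<open>site_kernel False\<close> and \<open>site_kernel True\<close> are the kernels of the orthogonal projections onto the
  scalar and onto the traceless matrices.\<close>

definition site_kernel :: "bool \<Rightarrow> 'q::finite \<Rightarrow> 'q \<Rightarrow> 'q \<Rightarrow> 'q \<Rightarrow> complex" where
  "site_kernel s a b x y =
    (if s then of_bool (a = x \<and> b = y) - of_bool (a = b \<and> x = y) / of_nat CARD('q)
     else of_bool (a = b \<and> x = y) / of_nat CARD('q))"

text \<open>The case of one site: \<open>s\<close> selects the projection whose indices are
  exchanged, \<open>u\<close> the projection of which this is the coefficient in the result.\<close>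

definition site_coeff :: "real \<Rightarrow> bool \<Rightarrow> bool \<Rightarrow> real" where
  "site_coeff q s u = (if s then if u then - 1 / q else (q\<^sup>2 - 1) / q else 1 / q)"

lemma cnj_site_kernel: "cnj (site_kernel s a b x y) = site_kernel s x y a b"
  by (auto simp: site_kernel_def)

lemma sum_of_bool_pair:
  fixes f :: "'a::finite \<Rightarrow> 'b::finite \<Rightarrow> complex"
  shows "(\<Sum>x\<in>UNIV. \<Sum>y\<in>UNIV. of_bool (a = x \<and> b = y) * f x y) = f a b"
proof -
  have "(\<Sum>x\<in>UNIV. \<Sum>y\<in>UNIV. of_bool (a = x \<and> b = y) * f x y) =
    (\<Sum>x\<in>UNIV. \<Sum>y\<in>UNIV. if y = b then (if x = a then f x y else 0) else 0)"
    by (intro sum.cong) auto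
  then show ?thesis
    by simp
qed

lemma sum_of_bool_diag:
  fixes f :: "'a::finite \<Rightarrow> 'a \<Rightarrow> complex"
  shows "(\<Sum>x\<in>UNIV. \<Sum>y\<in>UNIV. of_bool (P \<and> x = y) * f x y) = of_bool P * (\<Sum>x\<in>UNIV. f x x)"
proof -
  have "(\<Sum>x\<in>UNIV. \<Sum>y\<in>UNIV. of_bool (P \<and> x = y) * f x y) =
    (\<Sum>x\<in>UNIV. \<Sum>y\<in>UNIV. if y = x then (if P then f x y else 0) else 0)"
    by (intro sum.cong) auto
  then show ?thesis
    by simp
qed

lemma site_kernel_sum:
  "(\<Sum>x\<in>UNIV. \<Sum>y\<in>UNIV. site_kernel s a b x y * f x y) =
    (if s then f a b - of_bool (a = b) * (\<Sum>x\<in>UNIV. f x x) / of_nat CARD('q)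
     else of_bool (a = b) * (\<Sum>x\<in>UNIV. f x x) / of_nat CARD('q))"
  for a :: "'q::finite"
proof -
  have F: "(\<Sum>x\<in>UNIV. \<Sum>y\<in>UNIV. site_kernel False a b x y * f x y) =
    of_bool (a = b) * (\<Sum>x\<in>UNIV. f x x) / of_nat CARD('q)"
    by (simp add: site_kernel_def sum_divide_distrib [symmetric] sum_of_bool_diag
        del: of_bool_conj)
  have "(\<Sum>x\<in>UNIV. \<Sum>y\<in>UNIV. site_kernel True a b x y * f x y) =
    (\<Sum>x\<in>UNIV. \<Sum>y\<in>UNIV. of_bool (a = x \<and> b = y) * f x y) -
    (\<Sum>x\<in>UNIV. \<Sum>y\<in>UNIV. site_kernel False a b x y * f x y)"
    by (simp add: site_kernel_def left_diff_distrib sum_subtractf del: of_bool_conj)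
  then have "(\<Sum>x\<in>UNIV. \<Sum>y\<in>UNIV. site_kernel True a b x y * f x y) =
    f a b - of_bool (a = b) * (\<Sum>x\<in>UNIV. f x x) / of_nat CARD('q)"
    by (simp only: F sum_of_bool_pair)
  then show ?thesis
    using F by simp
qed

text \<open>The two maps are complementary idempotents, so equal ones compose to themselves and
  different ones to zero.\<close>

lemma site_kernel_comp:
  "(\<Sum>x\<in>UNIV. \<Sum>y\<in>UNIV. site_kernel s a b x y * site_kernel u x y c d) =
    of_bool (s = u) * site_kernel s a b c d"
  for a :: "'q::finite"
proof -
  have "(\<Sum>x\<in>UNIV. of_bool (x = c \<and> x = d)) = (\<Sum>x\<in>UNIV. if x = c then of_bool (c = d) else (0::complex))"
    by (intro sum.cong) auto
  then have "(\<Sum>x\<in>UNIV. of_bool (x = c \<and> x = d)) = (of_bool (c = d) :: complex)"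
    by simp
  \<comment> \<open>By \<open>site_kernel_sum\<close> the outer kernel sees, besides the entry
    itself, only a trace. The traceless part has trace zero and the scalar part keeps the whole
    trace.\<close>
  then have tr: "(\<Sum>x\<in>UNIV. site_kernel u x x c d) = (if u then 0 else of_bool (c = d))"
    by (simp add: site_kernel_def sum_subtractf del: of_bool_conj)
  show ?thesis
    unfolding site_kernel_sum tr by (auto simp: site_kernel_def)
qed

lemma site_kernel_add:
  "site_kernel True a b x y + site_kernel False a b x y = of_bool (a = x \<and> b = y)"
  by (simp add: site_kernel_def)

text \<open>Exchanging the two middle indices swaps the identity kernel
  \<open>P\<^sub>0 + P\<^sub>1\<close> with the trace kernel \<open>q P\<^sub>0\<close>. The
  coefficients follow by writing \<open>P\<^sub>0\<close> and \<open>P\<^sub>1\<close> as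
  combinations of these two.\<close>

lemma site_kernel_realign:
  "site_kernel s a b d c =
    complex_of_real (site_coeff (real CARD('q)) s True) * site_kernel True a d b c +
    complex_of_real (site_coeff (real CARD('q)) s False) * site_kernel False a d b c"
  for a :: "'q::finite"
  by (auto simp: site_kernel_def site_coeff_def field_simps power2_eq_square)

section \<open>Passing from one site to all sites\<close>

lemma sum_prod_fun:
  fixes f :: "'n::finite \<Rightarrow> 'q::finite \<Rightarrow> 'c::comm_semiring_1"
  shows "(\<Sum>x\<in>UNIV. \<Prod>k\<in>UNIV. f k (x k)) = (\<Prod>k\<in>UNIV. \<Sum>u\<in>UNIV. f k u)"
  using prod_sum_PiE [of UNIV "\<lambda>_. UNIV" f] by simp

lemma sum_prod_fun_pair:
  fixes f :: "'n::finite \<Rightarrow> 'q::finite \<Rightarrow> 'p::finite \<Rightarrow> 'c::comm_semiring_1"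
  shows "(\<Sum>x\<in>UNIV. \<Sum>y\<in>UNIV. \<Prod>k\<in>UNIV. f k (x k) (y k)) =
    (\<Prod>k\<in>UNIV. \<Sum>u\<in>UNIV. \<Sum>v\<in>UNIV. f k u v)"
proof -
  have "(\<Sum>x\<in>UNIV. \<Sum>y\<in>UNIV. \<Prod>k\<in>UNIV. f k (x k) (y k)) =
    (\<Sum>x\<in>UNIV. \<Prod>k\<in>UNIV. \<Sum>v\<in>UNIV. f k (x k) v)"
    by (intro sum.cong refl sum_prod_fun)
  also have "\<dots> = (\<Prod>k\<in>UNIV. \<Sum>u\<in>UNIV. \<Sum>v\<in>UNIV. f k u v)"
    by (rule sum_prod_fun [of "\<lambda>k u. \<Sum>v\<in>UNIV. f k u v"])
  finally show ?thesis .
qed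

text \<open>Expanding the product, \<open>J\<close> is the set of sites at which the first summand
  is chosen.\<close>

lemma prod_add_subsets:
  fixes f g :: "'n::finite \<Rightarrow> 'c::comm_semiring_1"
  shows "(\<Prod>k\<in>UNIV. f k + g k) = (\<Sum>J\<in>UNIV. \<Prod>k\<in>UNIV. if k \<in> J then f k else g k)"
proof -
  have "(\<Prod>k\<in>UNIV. if k \<in> J then f k else g k) = prod f J * prod g (UNIV - J)" for J :: "'n set"
    by (subst prod.If_cases) (auto simp: Compl_eq_Diff_UNIV)
  then show ?thesis
    using prod_add [of UNIV f g] by simp
qed

text \<open>The kernel of the tensor product of maps with \<open>P\<^sub>1\<close> at the sites of
  \<open>S\<close> and \<open>P\<^sub>0\<close> at all others.\<close>

definition support_kernel ::
    "'n::finite set \<Rightarrow> ('n \<Rightarrow> 'q::finite) \<Rightarrow> ('n \<Rightarrow> 'q) \<Rightarrow> ('n \<Rightarrow> 'q) \<Rightarrow> ('n \<Rightarrow> 'q) \<Rightarrow> complex" where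
  "support_kernel S a b x y = (\<Prod>k\<in>UNIV. site_kernel (k \<in> S) (a k) (b k) (x k) (y k))"

lemma cnj_support_kernel: "cnj (support_kernel S a b x y) = support_kernel S x y a b"
  by (simp add: support_kernel_def cnj_site_kernel)

lemma prod_of_bool: "finite A \<Longrightarrow> (\<Prod>k\<in>A. of_bool (P k)) = (of_bool (\<forall>k\<in>A. P k) :: 'c::comm_semiring_1)"
  by (induction A rule: finite_induct) auto

lemma support_kernel_comp:
  "(\<Sum>x\<in>UNIV. \<Sum>y\<in>UNIV. support_kernel S a b x y * support_kernel T x y c d) =
    of_bool (S = T) * support_kernel S a b c d"
proof -
  have "(\<Prod>k\<in>UNIV. of_bool ((k \<in> S) = (k \<in> T))) = (of_bool (S = T) :: complex)"
    by (subst prod_of_bool) auto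
  moreover have "(\<Sum>x\<in>UNIV. \<Sum>y\<in>UNIV. support_kernel S a b x y * support_kernel T x y c d) =
    (\<Prod>k\<in>UNIV. of_bool ((k \<in> S) = (k \<in> T)) * site_kernel (k \<in> S) (a k) (b k) (c k) (d k))"
    unfolding support_kernel_def prod.distrib [symmetric] site_kernel_comp [symmetric]
    by (rule sum_prod_fun_pair [of "\<lambda>k u v.
      site_kernel (k \<in> S) (a k) (b k) u v * site_kernel (k \<in> T) u v (c k) (d k)"])
  ultimately show ?thesis
    by (simp only: prod.distrib support_kernel_def)
qed

text \<open>Expands the tensor power of the one-site decomposition
  \<open>id = P\<^sub>1 + P\<^sub>0\<close>.\<close>

lemma sum_support_kernel: "(\<Sum>S\<in>UNIV. support_kernel S a b x y) = of_bool (a = x \<and> b = y)"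
proof -
  have "(\<Sum>S\<in>UNIV. support_kernel S a b x y) =
    (\<Sum>S\<in>UNIV. \<Prod>k\<in>UNIV. if k \<in> S then site_kernel True (a k) (b k) (x k) (y k)
      else site_kernel False (a k) (b k) (x k) (y k))"
    unfolding support_kernel_def by (intro sum.cong prod.cong) auto
  also have "\<dots> = (\<Prod>k\<in>UNIV. of_bool (a k = x k \<and> b k = y k))"
    by (simp only: prod_add_subsets [symmetric] site_kernel_add)
  also have "\<dots> = of_bool (a = x \<and> b = y)"
    by (subst prod_of_bool) (auto simp: fun_eq_iff)
  finally show ?thesis .
qed

text \<open>The exchange of indices acts at each site separately; multiplying out the one-site
  identities yields one term for each set \<open>J\<close> of sites that receive
  \<open>P\<^sub>1\<close>.\<close>

lemma support_kernel_realign: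
  "support_kernel S a b d c =
    (\<Sum>J\<in>UNIV. complex_of_real (\<Prod>k\<in>UNIV. site_coeff (real CARD('q)) (k \<in> S) (k \<in> J)) *
      support_kernel J a d b c)"
  for a :: "'n::finite \<Rightarrow> 'q::finite"
proof -
  let ?m = "\<lambda>s u. complex_of_real (site_coeff (real CARD('q)) s u)"
  have "support_kernel S a b d c =
    (\<Prod>k\<in>UNIV. ?m (k \<in> S) True * site_kernel True (a k) (d k) (b k) (c k) +
      ?m (k \<in> S) False * site_kernel False (a k) (d k) (b k) (c k))"
    unfolding support_kernel_def by (intro prod.cong refl site_kernel_realign)
  also have "\<dots> = (\<Sum>J\<in>UNIV. \<Prod>k\<in>UNIV.
      ?m (k \<in> S) (k \<in> J) * site_kernel (k \<in> J) (a k) (d k) (b k) (c k))"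
    unfolding prod_add_subsets by (intro sum.cong prod.cong) auto
  finally show ?thesis
    by (simp add: support_kernel_def prod.distrib)
qed

text \<open>The component of an operator that is traceless at each site of \<open>S\<close> and
  scalar at each other site. These components resolve the identity into mutually annihilating
  idempotents.\<close>

definition support_part :: "'n::finite set \<Rightarrow> ('n \<Rightarrow> 'q::finite) cmat \<Rightarrow> ('n \<Rightarrow> 'q) cmat" where
  "support_part S = kernel_map (support_kernel S)"

lemma support_part_comp:
  "support_part S (support_part T X) = (if S = T then support_part S X else 0)"
  by (simp add: support_part_def kernel_map_comp support_kernel_comp)
    (simp add: vec_eq_iff)

lemma sum_support_part: "(\<Sum>S\<in>UNIV. support_part S X) = X"
proof -
  have "(\<Sum>S\<in>UNIV. support_part S X) $ a $ b = X $ a $ b" for a b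
  proof -
    have "(\<Sum>S\<in>UNIV. support_part S X) $ a $ b =
      (\<Sum>S\<in>UNIV. \<Sum>x\<in>UNIV. \<Sum>y\<in>UNIV. support_kernel S a b x y * X $ x $ y)"
      by (simp add: support_part_def)
    also have "\<dots> = (\<Sum>x\<in>UNIV. \<Sum>S\<in>UNIV. \<Sum>y\<in>UNIV. support_kernel S a b x y * X $ x $ y)"
      by (rule sum.swap)
    also have "\<dots> = (\<Sum>x\<in>UNIV. \<Sum>y\<in>UNIV. \<Sum>S\<in>UNIV. support_kernel S a b x y * X $ x $ y)"
      by (intro sum.cong refl sum.swap)
    also have "\<dots> = X $ a $ b"
      by (simp only: sum_distrib_right [symmetric] sum_support_kernel sum_of_bool_pair)
    finally show ?thesis .
  qed
  then show ?thesis
    by (simp only: vec_eq_iff) simp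
qed

section \<open>Product operators and the filtration by the number of nonscalar sites\<close>

lemma support_part_tensor_product:
  "support_part S (tensor_product A) =
    tensor_product (\<lambda>k. kernel_map (site_kernel (k \<in> S)) (A k))"
proof -
  have "support_part S (tensor_product A) $ a $ b =
    tensor_product (\<lambda>k. kernel_map (site_kernel (k \<in> S)) (A k)) $ a $ b" for a b
    using sum_prod_fun_pair [of "\<lambda>k u v. site_kernel (k \<in> S) (a k) (b k) u v * A k $ u $ v"]
    by (simp add: support_part_def tensor_product_def support_kernel_def prod.distrib)
  then show ?thesis
    by (simp only: vec_eq_iff) simp
qed

lemma kernel_map_site_kernel_False:
  "kernel_map (site_kernel False) A = ((\<Sum>x\<in>UNIV. A $ x $ x) / of_nat CARD('q)) *\<^sub>M mat 1"
  for A :: "'q::finite cmat"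
  by (simp add: vec_eq_iff site_kernel_sum mat_def)

lemma kernel_map_site_kernel_True:
  "kernel_map (site_kernel True) A = A - kernel_map (site_kernel False) A"
  by (simp add: vec_eq_iff site_kernel_sum)

lemma kernel_map_site_kernel_True_scalar:
  "kernel_map (site_kernel True) (c *\<^sub>M mat 1) = 0"
  by (simp add: kernel_map_site_kernel_True kernel_map_site_kernel_False vec_eq_iff mat_def)

lemma matrix_unit_eq_tensor_product:
  "matrix_unit x y = tensor_product (\<lambda>k. matrix_unit (x k) (y k))"
  by (simp add: vec_eq_iff tensor_product_def prod_of_bool fun_eq_iff del: of_bool_conj) auto

text \<open>Matrix units are product operators, and the projection turns every factor outside
  \<open>S\<close> into a scalar matrix, leaving at most \<open>card S\<close> nonscalar factors.
  Linearity does the rest.\<close>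

lemma support_part_in_quantum_hamming:
  assumes "card S \<le> t"
  shows "support_part S X \<in> quantum_hamming t"
proof -
  have unit: "support_part S (matrix_unit x y) \<in> quantum_hamming t" for x y
  proof -
    let ?A = "\<lambda>k. kernel_map (site_kernel (k \<in> S)) (matrix_unit (x k) (y k))"
    have "\<exists>c. ?A k = c *\<^sub>M mat 1" if "k \<notin> S" for k
      using that kernel_map_site_kernel_False by (simp only:) blast
    then have "{k. \<not> (\<exists>c. ?A k = c *\<^sub>M mat 1)} \<subseteq> S"
      by blast
    then have "card {k. \<not> (\<exists>c. ?A k = c *\<^sub>M mat 1)} \<le> t"
      using assms by (meson card_mono finite order_trans)
    then have "tensor_product ?A \<in> quantum_hamming t"
      unfolding quantum_hamming_def by (intro cmat.span_base) blast
    then show ?thesis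
      by (simp add: matrix_unit_eq_tensor_product support_part_tensor_product)
  qed
  have "support_part S X \<in> cmat.span (range (\<lambda>(x, y). support_part S (matrix_unit x y)))"
    unfolding support_part_def by (rule kernel_map_in_span_units)
  also have "\<dots> \<subseteq> quantum_hamming t"
    using unit unfolding quantum_hamming_def
    by (intro cmat.span_minimal cmat.subspace_span) auto
  finally show ?thesis .
qed

text \<open>A generator with at most \<open>t\<close> nonscalar factors has a scalar factor at some
  site of the larger set \<open>S\<close>. The traceless part of that factor is zero, and with it
  the whole product.\<close>

lemma support_part_eq_0:
  fixes X :: "('n::finite \<Rightarrow> 'q::finite) cmat"
  assumes "X \<in> quantum_hamming t" "t < card S"
  shows "support_part S X = 0"
proof -
  have "quantum_hamming t \<subseteq> {X :: ('n \<Rightarrow> 'q) cmat. support_part S X = 0}"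
    unfolding quantum_hamming_def
  proof (rule cmat.span_minimal)
    show "cmat.subspace {X :: ('n \<Rightarrow> 'q) cmat. support_part S X = 0}"
      unfolding cmat.subspace_def
      by (auto simp: support_part_def kernel_map_add kernel_map_scale)
    show "{tensor_product A |A. card {k. \<not> (\<exists>c. A k = c *\<^sub>M mat 1)} \<le> t} \<subseteq> {X :: ('n \<Rightarrow> 'q) cmat. support_part S X = 0}"
    proof (rule subsetI)
      fix Y :: "('n \<Rightarrow> 'q) cmat"
      assume "Y \<in> {tensor_product A |A. card {k. \<not> (\<exists>c. A k = c *\<^sub>M mat 1)} \<le> t}"
      then obtain A where Y: "Y = tensor_product A"
        and A: "card {k. \<not> (\<exists>c. A k = c *\<^sub>M mat 1)} \<le> t"
        by blast
      have "\<not> S \<subseteq> {k. \<not> (\<exists>c. A k = c *\<^sub>M mat 1)}"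
        using A assms(2) card_mono [of "{k. \<not> (\<exists>c. A k = c *\<^sub>M mat 1)}" S] by auto
      then obtain k c where k: "k \<in> S" "A k = c *\<^sub>M mat 1"
        by auto
      then have "kernel_map (site_kernel (k \<in> S)) (A k) = 0"
        using kernel_map_site_kernel_True_scalar by simp
      then have "(\<Prod>k\<in>UNIV. kernel_map (site_kernel (k \<in> S)) (A k) $ x k $ y k) = 0" for x y
        by (intro prod_zero bexI [of _ k]) (simp_all del: kernel_map_nth)
      then have "support_part S (tensor_product A) $ x $ y = 0" for x y
        unfolding support_part_tensor_product unfolding tensor_product_def vec_lambda_beta .
      then have "support_part S Y = 0"
        unfolding Y by (simp only: vec_eq_iff zero_index) simp
      then show "Y \<in> {X :: ('n \<Rightarrow> 'q) cmat. support_part S X = 0}"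
        by simp
    qed
  qed
  then show ?thesis
    using assms(1) by auto
qed

subsection \<open>The graded parts of the quantum Hamming metric\<close>

text \<open>An explicit candidate for the orthogonal projection onto the graded part of degree
  \<open>t\<close>; \<open>basis_projection_graded_part\<close> confirms it.\<close>

definition weight_part :: "nat \<Rightarrow> ('n::finite \<Rightarrow> 'q::finite) cmat \<Rightarrow> ('n \<Rightarrow> 'q) cmat" where
  "weight_part t X = (\<Sum>S | card S = t. support_part S X)"

lemma support_part_sum: "support_part S (sum f A) = (\<Sum>i\<in>A. support_part S (f i))"
  by (simp add: support_part_def kernel_map_sum)

lemma support_part_weight_part:
  "support_part S (weight_part t X) = (if card S = t then support_part S X else 0)"
  by (simp add: weight_part_def support_part_sum support_part_comp)

lemma weight_part_comp:
  "weight_part t (weight_part u X) = (if t = u then weight_part t X else 0)"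
  unfolding weight_part_def [of t "weight_part u X"] support_part_weight_part
  by (auto simp: weight_part_def)

lemma sum_card_eq:
  fixes f :: "'n::finite set \<Rightarrow> 'b::comm_monoid_add"
  shows "(\<Sum>t\<le>CARD('n). \<Sum>S | card S = t. f S) = (\<Sum>S\<in>UNIV. f S)"
proof -
  have "range (card :: 'n set \<Rightarrow> nat) \<subseteq> {..CARD('n)}"
    by (auto intro!: card_mono)
  then show ?thesis
    using sum.group [of "UNIV :: 'n set set" "{..CARD('n)}" card f] by simp
qed

lemma sum_weight_part: "(\<Sum>t\<le>CARD('n). weight_part t X) = X"
  for X :: "('n::finite \<Rightarrow> 'q::finite) cmat"
  unfolding weight_part_def sum_card_eq by (rule sum_support_part)

lemma hs_inner_weight_part: "hs_inner (weight_part t E) F = hs_inner E (weight_part t F)"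
proof -
  \<comment> \<open>Conjugate symmetry moves the sum into the second argument, where
    \<open>hs_inner_sum_right\<close> applies.\<close>
  have "hs_inner (weight_part t E) F = cnj (\<Sum>S | card S = t. hs_inner F (support_part S E))"
    unfolding weight_part_def hs_inner_commute [of _ F] hs_inner_sum_right ..
  also have "\<dots> = (\<Sum>S | card S = t. hs_inner (support_part S E) F)"
    unfolding cnj_sum hs_inner_commute [of _ F] ..
  also have "\<dots> = (\<Sum>S | card S = t. hs_inner E (support_part S F))"
    unfolding support_part_def by (intro sum.cong refl hs_inner_kernel_map cnj_support_kernel)
  finally show ?thesis
    by (simp add: weight_part_def hs_inner_sum_right)
qed

lemma weight_part_in_quantum_hamming: "u \<le> t \<Longrightarrow> weight_part u X \<in> quantum_hamming t"
  using support_part_in_quantum_hamming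
  unfolding weight_part_def quantum_hamming_def by (intro cmat.span_sum) auto

lemma weight_part_eq_0: "X \<in> quantum_hamming t \<Longrightarrow> t < u \<Longrightarrow> weight_part u X = 0"
  using support_part_eq_0 unfolding weight_part_def by (intro sum.neutral) auto

text \<open>Reconciles the separate clause of \<open>graded_part\<close> for degree 0 with the
  filtration, so that every graded part lies in the filtration level of its degree.\<close>

lemma quantum_hamming_0:
  "quantum_hamming 0 = cmat.span {mat 1 :: ('n::finite \<Rightarrow> 'q::finite) cmat}"
proof (rule antisym)
  have one: "tensor_product (\<lambda>k. c k *\<^sub>M mat 1) = (\<Prod>k\<in>UNIV. c k) *\<^sub>M (mat 1 :: ('n \<Rightarrow> 'q) cmat)"
    for c :: "'n \<Rightarrow> complex"
  proof -
    have "(\<Prod>k\<in>UNIV. c k * of_bool (x k = y k)) = (\<Prod>k\<in>UNIV. c k) * of_bool (x = y)"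
      for x y :: "'n \<Rightarrow> 'q"
      unfolding prod.distrib by (subst prod_of_bool) (auto simp: fun_eq_iff)
    then show ?thesis
      by (simp add: vec_eq_iff tensor_product_def mat_def of_bool_def)
  qed
  show "quantum_hamming 0 \<subseteq> cmat.span {mat 1 :: ('n \<Rightarrow> 'q) cmat}"
    unfolding quantum_hamming_def
  proof (rule cmat.span_minimal)
    show "{tensor_product A |A. card {k. \<not> (\<exists>c. A k = c *\<^sub>M mat 1)} \<le> 0}
      \<subseteq> cmat.span {mat 1 :: ('n \<Rightarrow> 'q) cmat}"
    proof clarify
      fix A :: "'n \<Rightarrow> 'q cmat"
      assume "card {k. \<not> (\<exists>c. A k = c *\<^sub>M mat 1)} = 0"
      then have "\<forall>k. \<exists>c. A k = c *\<^sub>M mat 1"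
        by simp
      then obtain c where "A = (\<lambda>k. c k *\<^sub>M mat 1)"
        by metis
      then show "tensor_product A \<in> cmat.span {mat 1}"
        by (simp add: one cmat.span_scale cmat.span_base)
    qed
  qed simp
  have "mat 1 = tensor_product (\<lambda>k :: 'n. 1 *\<^sub>M mat 1 :: 'q cmat)"
    using one [of "\<lambda>_. 1"] by simp
  moreover have "card {k :: 'n. \<not> (\<exists>c. 1 *\<^sub>M mat 1 = c *\<^sub>M (mat 1 :: 'q cmat))} \<le> 0"
    by (simp only: le_0_eq card_eq_0_iff) blast
  ultimately have "mat 1 \<in> (quantum_hamming 0 :: ('n \<Rightarrow> 'q) cmat set)"
    unfolding quantum_hamming_def by (intro cmat.span_base) blast
  then show "cmat.span {mat 1 :: ('n \<Rightarrow> 'q) cmat} \<subseteq> quantum_hamming 0"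
    unfolding quantum_hamming_def by (intro cmat.span_minimal) auto
qed

text \<open>Membership in level \<open>t\<close> kills the components of weight above
  \<open>t\<close>, and orthogonality to level \<open>t - 1\<close> kills those below. Conversely,
  self-adjointness of \<open>weight_part t\<close> makes its fixed points orthogonal to the lower
  level.\<close>

lemma mem_graded_part_iff:
  fixes X :: "('n::finite \<Rightarrow> 'q::finite) cmat"
  shows "X \<in> graded_part quantum_hamming t \<longleftrightarrow> weight_part t X = X"
proof
  assume X: "X \<in> graded_part quantum_hamming t"
  then have mem: "X \<in> quantum_hamming t"
    by (auto simp: graded_part_def quantum_hamming_0 split: if_splits)
  have lower: "weight_part u X = 0" if "u < t" for u
  proof -
    have "X \<in> hs_complement (quantum_hamming (t - 1))"
      using X that by (auto simp: graded_part_def)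
    moreover have "weight_part u X \<in> quantum_hamming (t - 1)"
      using that by (intro weight_part_in_quantum_hamming) auto
    \<comment> \<open>The component of weight \<open>u\<close> lies in the space to which
      \<open>X\<close> is orthogonal. Moving one copy of the idempotent across the inner product
      makes this its squared norm.\<close>
    ultimately have "hs_inner (weight_part u (weight_part u X)) X = 0"
      by (simp add: hs_complement_def weight_part_comp)
    then have "hs_inner (weight_part u X) (weight_part u X) = 0"
      by (simp only: hs_inner_weight_part [of u "weight_part u X" X])
    then show ?thesis
      by (simp add: hs_inner_self_eq_0_iff)
  qed
  have "weight_part u X = (if u = t then weight_part t X else 0)" for u
    using lower weight_part_eq_0 [OF mem] by (cases u t rule: linorder_cases) auto
  then have "X = (\<Sum>u\<le>CARD('n). if u = t then weight_part t X else 0)"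
    using sum_weight_part [of X] by simp
  \<comment> \<open>Beyond the number of sites the index \<open>t\<close> is missing from the
    decomposition of \<open>X\<close>; no set of sites has that size, so both sides of the goal
    vanish.\<close>
  moreover have "weight_part t X = 0" if "\<not> t \<le> CARD('n)"
  proof -
    have no: "{S :: 'n set. card S = t} = {}"
      using that card_mono [OF finite subset_UNIV] by blast
    show ?thesis
      by (simp add: weight_part_def no)
  qed
  ultimately show "weight_part t X = X"
    by (cases "t \<le> CARD('n)") auto
next
  assume X: "weight_part t X = X"
  then have mem: "X \<in> quantum_hamming t"
    by (metis order_refl weight_part_in_quantum_hamming)
  moreover have "hs_inner E X = 0" if "t \<noteq> 0" "E \<in> quantum_hamming (t - 1)" for E
  proof -
    have "hs_inner E X = hs_inner (weight_part t E) X"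
      by (simp add: hs_inner_weight_part X)
    then show ?thesis
      using that by (simp add: weight_part_eq_0)
  qed
  ultimately show "X \<in> graded_part quantum_hamming t"
    by (auto simp: graded_part_def hs_complement_def quantum_hamming_0)
qed

section \<open>Orthonormal bases and orthogonal projections of the graded parts\<close>

lemma weight_part_eq_kernel_map:
  "weight_part t = kernel_map (\<lambda>a b x y. \<Sum>S | card S = t. support_kernel S a b x y)"
proof
  fix X :: "('n::finite \<Rightarrow> 'q::finite) cmat"
  have "weight_part t X $ a $ b =
    (\<Sum>x\<in>UNIV. \<Sum>y\<in>UNIV. (\<Sum>S | card S = t. support_kernel S a b x y) * X $ x $ y)" for a b
  proof -
    have "weight_part t X $ a $ b =
      (\<Sum>S | card S = t. \<Sum>x\<in>UNIV. \<Sum>y\<in>UNIV. support_kernel S a b x y * X $ x $ y)"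
      by (simp add: weight_part_def support_part_def)
    also have "\<dots> = (\<Sum>x\<in>UNIV. \<Sum>S | card S = t. \<Sum>y\<in>UNIV. support_kernel S a b x y * X $ x $ y)"
      by (rule sum.swap)
    also have "\<dots> = (\<Sum>x\<in>UNIV. \<Sum>y\<in>UNIV. \<Sum>S | card S = t. support_kernel S a b x y * X $ x $ y)"
      by (intro sum.cong refl sum.swap)
    finally show ?thesis
      by (simp only: sum_distrib_right)
  qed
  then show "weight_part t X = kernel_map (\<lambda>a b x y. \<Sum>S | card S = t. support_kernel S a b x y) X"
    by (simp only: vec_eq_iff kernel_map_nth) simp
qed

lemma graded_part_basis_exists:
  "\<exists>B. hs_orthonormal_basis B
    (graded_part (quantum_hamming :: nat \<Rightarrow> ('n::finite \<Rightarrow> 'q::finite) cmat set) t)"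
proof -
  let ?V = "graded_part (quantum_hamming :: nat \<Rightarrow> ('n \<Rightarrow> 'q) cmat set) t"
  let ?U = "range (\<lambda>(x, y). weight_part t (matrix_unit x y)) :: ('n \<Rightarrow> 'q) cmat set"
  have "cmat.span ?U = ?V"
  proof (rule antisym)
    have "cmat.subspace ?V"
      unfolding cmat.subspace_def Ball_def mem_graded_part_iff
      by (auto simp: weight_part_eq_kernel_map kernel_map_add kernel_map_scale)
    then show "cmat.span ?U \<subseteq> ?V"
      by (intro cmat.span_minimal) (auto simp: mem_graded_part_iff weight_part_comp)
    have "weight_part t X \<in> cmat.span ?U" for X
      unfolding weight_part_eq_kernel_map by (rule kernel_map_in_span_units)
    then show "?V \<subseteq> cmat.span ?U"
      unfolding mem_graded_part_iff subset_iff by metis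
  qed
  moreover have "finite ?U"
    by simp
  ultimately show ?thesis
    using orthonormal_basis_exists by metis
qed

lemma basis_projection_graded_part:
  assumes "hs_orthonormal_basis B (graded_part quantum_hamming t)"
  shows "basis_projection B X = weight_part t X"
proof (rule basis_projection_unique [OF assms])
  show "weight_part t X \<in> graded_part quantum_hamming t"
    by (simp add: mem_graded_part_iff weight_part_comp)
  show "hs_inner E (X - weight_part t X) = 0" if "E \<in> graded_part quantum_hamming t" for E
    using that by (simp add: mem_graded_part_iff hs_inner_diff_right hs_inner_weight_part [symmetric])
qed

subsection \<open>The coefficients\<close>

text \<open>The Krawtchouk polynomial of degree \<open>t\<close> for length \<open>n\<close> and an
  alphabet of \<open>q\<^sup>2\<close> letters, evaluated at \<open>j\<close> and divided by
  \<open>q ^ n\<close>.\<close>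

definition hamming_coeff :: "real \<Rightarrow> nat \<Rightarrow> nat \<Rightarrow> nat \<Rightarrow> real" where
  "hamming_coeff q n t j = 1 / q ^ n *
    (\<Sum>s=0..t. (-1) ^ s * (q ^ 2 - 1) ^ (t - s) * real (j choose s) * real ((n - j) choose (t - s)))"

text \<open>The sets \<open>S\<close> correspond to pairs consisting of \<open>S \<inter> J\<close>
  and \<open>S - J\<close>, chosen independently inside and outside \<open>J\<close>. The bound on
  \<open>s\<close> keeps the subtraction \<open>t - s\<close> exact.\<close>

lemma card_subsets_by_inter:
  fixes J :: "'n::finite set"
  assumes "s \<le> t"
  shows "card {S. card S = t \<and> card (S \<inter> J) = s} =
    (card J choose s) * ((CARD('n) - card J) choose (t - s))"
proof -
  have "bij_betw (\<lambda>S. (S \<inter> J, S - J)) {S. card S = t \<and> card (S \<inter> J) = s}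
    ({A. A \<subseteq> J \<and> card A = s} \<times> {A. A \<subseteq> - J \<and> card A = t - s})"
  proof (rule bij_betw_byWitness [where f' = "\<lambda>(A, B). A \<union> B"])
    show "(\<lambda>S. (S \<inter> J, S - J)) ` {S. card S = t \<and> card (S \<inter> J) = s}
      \<subseteq> {A. A \<subseteq> J \<and> card A = s} \<times> {A. A \<subseteq> - J \<and> card A = t - s}"
      by (auto simp: card_Diff_subset_Int)
    have "card (A \<union> B) = t \<and> card ((A \<union> B) \<inter> J) = s"
      if "A \<subseteq> J" "card A = s" "B \<subseteq> - J" "card B = t - s" for A B
    proof -
      have "(A \<union> B) \<inter> J = A" "A \<inter> B = {}"
        using that by auto
      then show ?thesis
        using that assms by (simp add: card_Un_disjoint)
    qed
    then show "(\<lambda>(A, B). A \<union> B) ` ({A. A \<subseteq> J \<and> card A = s} \<times> {A. A \<subseteq> - J \<and> card A = t - s})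
      \<subseteq> {S. card S = t \<and> card (S \<inter> J) = s}"
      by auto
  qed auto
  from bij_betw_same_card [OF this] show ?thesis
    by (simp add: card_cartesian_product n_subsets Compl_eq_Diff_UNIV card_Diff_subset)
qed

lemma sum_prod_site_coeff:
  fixes J :: "'n::finite set"
  shows "(\<Sum>S | card S = t. \<Prod>k\<in>UNIV. site_coeff q (k \<in> S) (k \<in> J)) =
    hamming_coeff q CARD('n) t (card J)"
proof -
  let ?g = "\<lambda>S. \<Prod>k\<in>UNIV. site_coeff q (k \<in> S) (k \<in> J)"
  have pow: "(\<Prod>k\<in>UNIV. if k \<in> A then c else 1) = c ^ card A" for A :: "'n set" and c :: real
    by (simp add: prod.If_cases)
  have g: "?g S = 1 / q ^ CARD('n) * ((-1) ^ card (S \<inter> J) * (q\<^sup>2 - 1) ^ card (S - J))" for S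
  proof -
    \<comment> \<open>Each site contributes \<open>1 / q\<close>, times a sign on
      \<open>S \<inter> J\<close> and \<open>q\<^sup>2 - 1\<close> on \<open>S - J\<close>, so the
      product depends only on two cardinalities.\<close>
    have "?g S = (\<Prod>k\<in>UNIV. 1 / q * ((if k \<in> S \<inter> J then - 1 else 1) *
      (if k \<in> S - J then q\<^sup>2 - 1 else 1)))"
      by (intro prod.cong) (auto simp: site_coeff_def)
    also have "\<dots> = (1 / q) ^ CARD('n) * ((-1) ^ card (S \<inter> J) * (q\<^sup>2 - 1) ^ card (S - J))"
      unfolding prod.distrib pow by simp
    finally show ?thesis
      by (simp add: power_divide)
  qed
  have "(\<Sum>S | card S = t. ?g S) =
    (\<Sum>s=0..t. \<Sum>S | S \<in> {S. card S = t} \<and> card (S \<inter> J) = s. ?g S)"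
    by (intro sum.group [symmetric]) (auto intro!: card_mono)
  also have "\<dots> = (\<Sum>s=0..t. 1 / q ^ CARD('n) * ((-1) ^ s * (q ^ 2 - 1) ^ (t - s) *
      real (card J choose s) * real ((CARD('n) - card J) choose (t - s))))"
  proof (intro sum.cong refl)
    fix s assume "s \<in> {0..t}"
    then have "s \<le> t"
      by simp
    have "(\<Sum>S | S \<in> {S. card S = t} \<and> card (S \<inter> J) = s. ?g S) =
      (\<Sum>S | card S = t \<and> card (S \<inter> J) = s. 1 / q ^ CARD('n) * ((-1) ^ s * (q\<^sup>2 - 1) ^ (t - s)))"
    proof (intro sum.cong)
      fix S assume "S \<in> {S. card S = t \<and> card (S \<inter> J) = s}"
      then have "card S = t" "card (S \<inter> J) = s"
        by auto
      moreover have "card (S - J) = card S - card (S \<inter> J)"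
        by (simp add: card_Diff_subset_Int)
      ultimately show "?g S = 1 / q ^ CARD('n) * ((-1) ^ s * (q\<^sup>2 - 1) ^ (t - s))"
        unfolding g by simp
    qed auto
    then show "(\<Sum>S | S \<in> {S. card S = t} \<and> card (S \<inter> J) = s. ?g S) =
      1 / q ^ CARD('n) * ((-1) ^ s * (q ^ 2 - 1) ^ (t - s) *
        real (card J choose s) * real ((CARD('n) - card J) choose (t - s)))"
      by (simp add: card_subsets_by_inter [OF \<open>s \<le> t\<close>] mult_ac)
  qed
  finally show ?thesis
    by (simp only: hamming_coeff_def sum_distrib_left)
qed

text \<open>The projection kernel summed over all \<open>S\<close> of size \<open>t\<close> is
  realigned into a combination of support kernels. The coefficient at \<open>J\<close> depends only
  on \<open>card J\<close>, so the terms collect into weight components.\<close>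

lemma kraus_map_graded_part:
  fixes X :: "('n::finite \<Rightarrow> 'q::finite) cmat"
  assumes "hs_orthonormal_basis B (graded_part quantum_hamming t)"
  shows "kraus_map B X =
    (\<Sum>j\<le>CARD('n). hamming_coeff (real CARD('q)) CARD('n) t j *\<^sub>R weight_part j X)"
proof -
  let ?m = "\<lambda>S J. \<Prod>k\<in>UNIV. site_coeff (real CARD('q)) (k \<in> S) (k \<in> J)"
  let ?h = "hamming_coeff (real CARD('q)) CARD('n) t"
  have realign: "(\<Sum>S | card S = t. support_kernel S a b d c) =
    (\<Sum>J\<in>UNIV. complex_of_real (?h (card J)) * support_kernel J a d b c)"
    for a b c d :: "'n \<Rightarrow> 'q"
  proof -
    have "(\<Sum>S | card S = t. support_kernel S a b d c) =
      (\<Sum>S | card S = t. \<Sum>J\<in>UNIV. complex_of_real (?m S J) * support_kernel J a d b c)"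
      by (intro sum.cong refl support_kernel_realign)
    also have "\<dots> = (\<Sum>J\<in>UNIV. \<Sum>S | card S = t. complex_of_real (?m S J) * support_kernel J a d b c)"
      by (rule sum.swap)
    also have "\<dots> = (\<Sum>J\<in>UNIV. complex_of_real (\<Sum>S | card S = t. ?m S J) * support_kernel J a d b c)"
      by (simp only: of_real_sum sum_distrib_right)
    finally show ?thesis
      by (simp add: sum_prod_site_coeff)
  qed
  have "kraus_map B X $ a $ d = (\<Sum>J\<in>UNIV. ?h (card J) *\<^sub>R support_part J X) $ a $ d" for a d
  proof -
    \<comment> \<open>The order \<open>a b d c\<close> is that of the projection kernel; after
      \<open>realign\<close> it reads \<open>a d b c\<close>, a kernel producing the entry
      \<open>(a, d)\<close> from the entries \<open>(b, c)\<close> of \<open>X\<close>.\<close>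
    have "kraus_map B X $ a $ d =
      (\<Sum>b\<in>UNIV. \<Sum>c\<in>UNIV. (\<Sum>S | card S = t. support_kernel S a b d c) * X $ b $ c)"
      by (simp only: kraus_map_nth basis_projection_graded_part [OF assms]
          weight_part_eq_kernel_map kernel_map_matrix_unit)
    also have "\<dots> = (\<Sum>b\<in>UNIV. \<Sum>c\<in>UNIV. \<Sum>J\<in>UNIV.
        complex_of_real (?h (card J)) * support_kernel J a d b c * X $ b $ c)"
      by (simp only: realign sum_distrib_right)
    also have "\<dots> = (\<Sum>b\<in>UNIV. \<Sum>J\<in>UNIV. \<Sum>c\<in>UNIV.
        complex_of_real (?h (card J)) * support_kernel J a d b c * X $ b $ c)"
      by (intro sum.cong refl sum.swap)
    also have "\<dots> = (\<Sum>J\<in>UNIV. \<Sum>b\<in>UNIV. \<Sum>c\<in>UNIV.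
        complex_of_real (?h (card J)) * support_kernel J a d b c * X $ b $ c)"
      by (rule sum.swap)
    also have "\<dots> = (\<Sum>J\<in>UNIV. ?h (card J) *\<^sub>R support_part J X) $ a $ d"
      by (simp add: support_part_def)
        (simp add: scaleR_conv_of_real sum_distrib_left mult.assoc)
    finally show ?thesis .
  qed
  then have "kraus_map B X = (\<Sum>J\<in>UNIV. ?h (card J) *\<^sub>R support_part J X)"
    by (simp only: vec_eq_iff) simp
  also have "\<dots> = (\<Sum>j\<le>CARD('n). \<Sum>J | card J = j. ?h (card J) *\<^sub>R support_part J X)"
    by (rule sum_card_eq [symmetric])
  also have "\<dots> = (\<Sum>j\<le>CARD('n). ?h j *\<^sub>R weight_part j X)"
    unfolding weight_part_def scaleR_sum_right by (intro sum.cong) auto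
  finally show ?thesis .
qed

text \<open>Supplies test operators for uniqueness: a nonzero traceless diagonal matrix at each of
  \<open>j\<close> sites and the identity elsewhere. Two distinct levels at a site are what make
  such a matrix available.\<close>

lemma self_adjoint_weight_exists:
  assumes "CARD('q::finite) \<ge> 2" "j \<le> CARD('n::finite)"
  obtains X :: "('n::finite \<Rightarrow> 'q::finite) cmat"
  where "self_adjoint X" "X \<noteq> 0" "\<And>i. weight_part i X = (if i = j then X else 0)"
proof -
  have "\<exists>a b :: 'q. a \<noteq> b"
    using assms(1) by (metis (full_types) card_le_Suc0_iff_eq
        finite_class.finite_UNIV not_less_eq_eq numeral_2_eq_2)
  then obtain a b :: 'q where "a \<noteq> b"
    by blast
  obtain J :: "'n set" where J: "card J = j"
    using assms(2) by (meson obtain_subset_with_card_n)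
  define D :: "'q cmat" where "D = matrix_unit a a - matrix_unit b b"
  define A where "A = (\<lambda>k. if k \<in> J then D else mat 1)"
  define X :: "('n \<Rightarrow> 'q) cmat" where "X = tensor_product A"
  have "(\<Sum>x\<in>UNIV. D $ x $ x) = 0"
    by (simp add: D_def sum_subtractf of_bool_def)
  then have "kernel_map (site_kernel True) D = D"
    by (simp add: kernel_map_site_kernel_True kernel_map_site_kernel_False)
  moreover have "kernel_map (site_kernel False) (mat 1 :: 'q cmat) = mat 1"
    by (simp only: kernel_map_site_kernel_False) (simp add: mat_def)
  ultimately have "kernel_map (site_kernel (k \<in> J)) (A k) = A k" for k
    by (simp add: A_def)
  then have fixed: "support_part J X = X"
    by (simp add: X_def support_part_tensor_product)
  have supp: "support_part S X = (if S = J then X else 0)" for S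
    by (metis fixed support_part_comp)
  have "cnj (A k $ x $ y) = A k $ y $ x" for k x y
    by (auto simp: A_def D_def mat_def)
  then have "self_adjoint X"
    by (simp add: self_adjoint_def cmat_adjoint_def X_def tensor_product_def vec_eq_iff)
  \<comment> \<open>At this diagonal entry every factor, whether \<open>D\<close> or the identity,
    contributes 1.\<close>
  moreover have "X $ (\<lambda>_. a) $ (\<lambda>_. a) = 1"
    using \<open>a \<noteq> b\<close> by (auto simp: X_def tensor_product_def A_def D_def mat_def intro!: prod.neutral)
  then have "X \<noteq> 0"
    by auto
  moreover have "weight_part i X = (if i = j then X else 0)" for i
    using J by (auto simp: weight_part_def supp)
  ultimately show ?thesis
    by (rule that)
qed

theorem proposition3p6p1:
  fixes t j :: nat
  assumes "CARD('q::finite) \<ge> 2"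
    and "t \<le> CARD('n::finite)" and "j \<le> CARD('n)"
  shows "W_coeff (quantum_hamming :: nat \<Rightarrow> ('n \<Rightarrow> 'q) cmat set) CARD('n) t j =
    1 / real CARD('q) ^ CARD('n) *
      (\<Sum>s=0..t. (-1) ^ s * (real CARD('q) ^ 2 - 1) ^ (t - s) *
         real (j choose s) * real ((CARD('n) - j) choose (t - s)))"
proof -
  let ?E = "quantum_hamming :: nat \<Rightarrow> ('n \<Rightarrow> 'q) cmat set"
  let ?h = "hamming_coeff (real CARD('q)) CARD('n) t"
  \<comment> \<open>The restriction takes the default value \<open>undefined\<close> above
    \<open>CARD('n)\<close>, as extensionality demands of the unique tuple.\<close>
  have "W_coeff ?E CARD('n) t = restrict ?h {..CARD('n)}"
    unfolding W_coeff_def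
  proof (rule the_equality)
    show "restrict ?h {..CARD('n)} \<in> extensional {..CARD('n)} \<and>
      (\<forall>B X. (\<forall>j\<le>CARD('n). hs_orthonormal_basis (B j) (graded_part ?E j)) \<longrightarrow> self_adjoint X \<longrightarrow>
        kraus_map (B t) X =
          (\<Sum>j\<le>CARD('n). restrict ?h {..CARD('n)} j *\<^sub>R basis_projection (B j) X))"
    proof (intro conjI allI impI)
      fix B and X :: "('n \<Rightarrow> 'q) cmat"
      assume B: "\<forall>j\<le>CARD('n). hs_orthonormal_basis (B j) (graded_part ?E j)"
      have "kraus_map (B t) X = (\<Sum>j\<le>CARD('n). ?h j *\<^sub>R weight_part j X)"
        using B assms(2) by (intro kraus_map_graded_part) auto
      also have "\<dots> = (\<Sum>j\<le>CARD('n). restrict ?h {..CARD('n)} j *\<^sub>R basis_projection (B j) X)"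
        using B by (intro sum.cong) (auto simp: basis_projection_graded_part)
      finally show "kraus_map (B t) X =
        (\<Sum>j\<le>CARD('n). restrict ?h {..CARD('n)} j *\<^sub>R basis_projection (B j) X)" .
    qed simp
  next
    fix w :: "nat \<Rightarrow> real"
    assume w: "w \<in> extensional {..CARD('n)} \<and>
      (\<forall>B X. (\<forall>j\<le>CARD('n). hs_orthonormal_basis (B j) (graded_part ?E j)) \<longrightarrow> self_adjoint X \<longrightarrow>
        kraus_map (B t) X = (\<Sum>j\<le>CARD('n). w j *\<^sub>R basis_projection (B j) X))"
    obtain B where B: "\<And>j. hs_orthonormal_basis (B j) (graded_part ?E j)"
      using graded_part_basis_exists by metis
    \<comment> \<open>On a nonzero self-adjoint operator of pure weight \<open>i\<close> both
      expansions reduce to a single multiple of that operator, so the coefficients can be compared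
      one at a time.\<close>
    have "w i = ?h i" if i: "i \<le> CARD('n)" for i
    proof -
      obtain X :: "('n \<Rightarrow> 'q) cmat" where X: "self_adjoint X" "X \<noteq> 0"
        and part: "\<And>k. weight_part k X = (if k = i then X else 0)"
        using self_adjoint_weight_exists [OF assms(1) i] by blast
      have pick: "(\<Sum>k\<le>CARD('n). c k *\<^sub>R weight_part k X) = c i *\<^sub>R X" for c :: "nat \<Rightarrow> real"
      proof -
        have "(\<Sum>k\<le>CARD('n). c k *\<^sub>R weight_part k X) =
          (\<Sum>k\<le>CARD('n). if k = i then c k *\<^sub>R X else 0)"
          by (intro sum.cong) (auto simp: part)
        then show ?thesis
          using i by simp
      qed
      have "w i *\<^sub>R X = kraus_map (B t) X"
        using w B X(1) by (simp add: basis_projection_graded_part [OF B] pick)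
      also have "\<dots> = ?h i *\<^sub>R X"
        by (simp add: kraus_map_graded_part [OF B] pick)
      finally show ?thesis
        using X(2) by simp
    qed
    then show "w = restrict ?h {..CARD('n)}"
      using w by (intro extensionalityI [of _ "{..CARD('n)}"]) auto
  qed
  then show ?thesis
    using assms(3) by (simp add: hamming_coeff_def)
qed

end
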